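(* Let $\mathcal{A}$ be a union-closed family with universe $[n]$ and length $\ell$, let $C_1=[n]\supsetneq C_2\supsetneq\cdots\supsetneq C_{\ell+1}$ be a chain in $\mathcal{A}$ of maximum size, and define $\mathcal{D}_i$ for $i\in[\ell]$ as in the context. Then \[|\mathcal{A}| = 1+\sum_{i=1}^{\ell}|\mathcal{D}_i|.\]
   Context: A family is a finite family of distinct finite sets, at least one of which is nonempty; its universe is $U(\mathcal{A})=\bigcup_{A\in\mathcal{A}}A$. $\mathcal{A}$ is union-closed if $X_1,X_2\in\mathcal{A}$ implies $X_1\cup X_2\in\mathcal{A}$. A chain is a subfamily any two of whose members are comparable under inclusion; the length $\ell(\mathcal{A})$ is one less than the maximum size of a chain in $\mathcal{A}$. Note that $[n]\in\mathcal{A}$ and belongs to every maximum chain, so a maximum chain can be written $C_1=[n]\supsetneq C_2\supsetneq\cdots\supsetneq C_{\ell+1}$. With $[0]=\emptyset$, for each $i\in[\ell]$ define \[\mathcal{C}_i=\Big\{X\in\mathcal{A} : C_i\setminus C_{i+1}\subseteq X \text{ and } X\cap \textstyle\bigcup_{j\in[i-1]}(C_j\setminus C_{j+1})=\emptyset\Big\},\qquad \mathcal{D}_i=\{X\setminus (C_i\setminus C_{i+1}) : X\in\mathcal{C}_i\}.\] *)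

theory Defs
  imports Main
begin

definition set_family :: "'a set set \<Rightarrow> bool" where
  "set_family \<A> \<longleftrightarrow> finite \<A> \<and> (\<forall>A\<in>\<A>. finite A) \<and> (\<exists>A\<in>\<A>. A \<noteq> {})"

abbreviation universe :: "'a set set \<Rightarrow> 'a set" where
  "universe \<A> \<equiv> \<Union>\<A>"

definition union_closed :: "'a set set \<Rightarrow> bool" where
  "union_closed \<A> \<longleftrightarrow> (\<forall>X\<in>\<A>. \<forall>Y\<in>\<A>. X \<union> Y \<in> \<A>)"

definition fam_length :: "'a set set \<Rightarrow> nat" where
  "fam_length \<A> = Max (card ` chains \<A>) - 1"

definition max_size_chain :: "'a set set \<Rightarrow> 'a set set \<Rightarrow> bool" where
  "max_size_chain \<A> \<K> \<longleftrightarrow> \<K> \<in> chains \<A> \<and> (\<forall>\<L>\<in>chains \<A>. card \<L> \<le> card \<K>)"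

text \<open>Chains are indexed from 1: \<open>C 1 \<supset> C 2 \<supset> \<dots>\<close>; the value \<open>C 0\<close> is irrelevant.\<close>

definition \<C>_fam :: "'a set set \<Rightarrow> (nat \<Rightarrow> 'a set) \<Rightarrow> nat \<Rightarrow> 'a set set" where
  "\<C>_fam \<A> C i = {X \<in> \<A>. C i - C (i + 1) \<subseteq> X \<and> X \<inter> (\<Union>j\<in>{1..i - 1}. C j - C (j + 1)) = {}}"

definition \<D>_fam :: "'a set set \<Rightarrow> (nat \<Rightarrow> 'a set) \<Rightarrow> nat \<Rightarrow> 'a set set" where
  "\<D>_fam \<A> C i = {X - (C i - C (i + 1)) | X. X \<in> \<C>_fam \<A> C i}"

end

theory Submission
  imports Defs
begin

text \<open>Count the members of \<open>\<A>\<close> lying below each \<open>C i\<close>. A member \<open>X\<close> below \<open>C i\<close> but not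
  below \<open>C (i + 1)\<close> satisfies \<open>C (i + 1) \<subset> C (i + 1) \<union> X \<subseteq> C i\<close>; since a maximum chain
  cannot be refined, the last inclusion is an equality, that is, \<open>X\<close> contains \<open>C i - C (i + 1)\<close>.
  So the members that drop out in passing from \<open>C i\<close> to \<open>C (i + 1)\<close> are exactly those of
  \<open>\<C>_fam \<A> C i\<close>, which is in bijection with \<open>\<D>_fam \<A> C i\<close>. Only the last
  member of the chain is left at the end, and the counts telescope.\<close>

text \<open>Every member of \<open>\<C>_fam \<A> C i\<close> contains the set being removed, so it
  can be recovered by adding that set back.\<close>

lemma card_\<D>_fam: "card (\<D>_fam \<A> C i) = card (\<C>_fam \<A> C i)"
proof -
  have "\<D>_fam \<A> C i = (\<lambda>X. X - (C i - C (i + 1))) ` \<C>_fam \<A> C i"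
    unfolding \<D>_fam_def by blast
  moreover have "inj_on (\<lambda>X. X - (C i - C (i + 1))) (\<C>_fam \<A> C i)"
    unfolding inj_on_def \<C>_fam_def by blast
  ultimately show ?thesis
    by (simp add: card_image)
qed

lemma decreasing_le:
  fixes C :: "nat \<Rightarrow> 'a set"
  assumes "\<And>i. i \<in> {1..l} \<Longrightarrow> C (i + 1) \<subset> C i"
    and "1 \<le> i" "i \<le> j" "j \<le> l + 1"
  shows "C j \<subseteq> C i"
  using assms(3,4)
proof (induction j rule: dec_induct)
  case (step k)
  have "C (k + 1) \<subset> C k"
    using assms(1)[of k] assms(2) step by simp
  with step show ?case
    by auto
qed simp

text \<open>The differences telescope. This turns the disjointness condition in
  \<open>\<C>_fam\<close> into one about \<open>C i\<close> alone.\<close>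

lemma UN_differences_decreasing:
  fixes C :: "nat \<Rightarrow> 'a set"
  assumes dec: "\<And>i. i \<in> {1..l} \<Longrightarrow> C (i + 1) \<subset> C i"
    and "1 \<le> i" "i \<le> l + 1"
  shows "(\<Union>j\<in>{1..i - 1}. C j - C (j + 1)) = C 1 - C i"
  using assms(2,3)
proof (induction i rule: dec_induct)
  case (step k)
  have "{1..Suc k - 1} = insert k {1..k - 1}"
    using step by auto
  moreover have "C (k + 1) \<subseteq> C k" "C k \<subseteq> C 1"
    using decreasing_le[of l C k "k + 1", OF dec] decreasing_le[of l C 1 k, OF dec] step by auto
  ultimately show ?case
    using step by auto
qed simp

text \<open>Otherwise inserting \<open>Y\<close> would give a longer chain; finiteness of
  \<open>\<K>\<close> ensures that \<open>card\<close> really grows.\<close>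

lemma max_size_chain_memI:
  assumes "max_size_chain \<A> \<K>" "finite \<K>" "Y \<in> \<A>"
    and "\<And>K. K \<in> \<K> \<Longrightarrow> K \<subseteq> Y \<or> Y \<subseteq> K"
  shows "Y \<in> \<K>"
proof (rule ccontr)
  assume "Y \<notin> \<K>"
  have "insert Y \<K> \<in> chains \<A>"
    using assms unfolding max_size_chain_def chains_def chain_subset_def by blast
  then have "card (insert Y \<K>) \<le> card \<K>"
    using assms(1) unfolding max_size_chain_def by blast
  with \<open>Y \<notin> \<K>\<close> assms(2) show False
    by simp
qed

lemma max_size_chain_no_between:
  fixes C :: "nat \<Rightarrow> 'a set"
  assumes max: "max_size_chain \<A> (C ` {1..l + 1})"
    and dec: "\<And>i. i \<in> {1..l} \<Longrightarrow> C (i + 1) \<subset> C i"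
    and "i \<in> {1..l}" "Y \<in> \<A>" "C (i + 1) \<subset> Y" "Y \<subseteq> C i"
  shows "Y = C i"
proof -
  \<comment> \<open>No chain member lies strictly between two consecutive ones. Hence
    \<open>Y\<close> is comparable with all of them and so belongs to the chain, where only
    \<open>C i\<close> fits.\<close>
  have split: "C i \<subseteq> C k \<or> C k \<subseteq> C (i + 1)" if "k \<in> {1..l + 1}" for k
    using decreasing_le[of l C k i, OF dec] decreasing_le[of l C "i + 1" k, OF dec] that assms(3)
    by (cases "k \<le> i") auto
  have "Y \<in> C ` {1..l + 1}"
    by (rule max_size_chain_memI[OF max _ assms(4)]) (use split assms(5,6) in blast)+
  with split assms(5,6) show ?thesis
    by blast
qed

text \<open>Such a \<open>Y\<close> lies below the whole chain, so it already belongs to it, and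
  \<open>C (l + 1)\<close> is the least member.\<close>

lemma max_size_chain_last_minimal:
  fixes C :: "nat \<Rightarrow> 'a set"
  assumes max: "max_size_chain \<A> (C ` {1..l + 1})"
    and dec: "\<And>i. i \<in> {1..l} \<Longrightarrow> C (i + 1) \<subset> C i"
    and "Y \<in> \<A>" "Y \<subseteq> C (l + 1)"
  shows "Y = C (l + 1)"
proof -
  have last: "C (l + 1) \<subseteq> C k" if "k \<in> {1..l + 1}" for k
    using decreasing_le[of l C k "l + 1", OF dec] that by auto
  have "Y \<in> C ` {1..l + 1}"
    by (rule max_size_chain_memI[OF max _ assms(3)]) (use last assms(4) in blast)+
  with last assms(4) show ?thesis
    by blast
qed

lemma card_below_Suc:
  fixes C :: "nat \<Rightarrow> 'a set"
  assumes "finite \<A>" "union_closed \<A>" "\<Union>\<A> \<subseteq> C 1"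
    and max: "max_size_chain \<A> (C ` {1..l + 1})"
    and dec: "\<And>i. i \<in> {1..l} \<Longrightarrow> C (i + 1) \<subset> C i"
    and i: "i \<in> {1..l}"
  shows "card {X \<in> \<A>. X \<subseteq> C i} = card {X \<in> \<A>. X \<subseteq> C (i + 1)} + card (\<C>_fam \<A> C i)"
proof -
  have "(\<Union>j\<in>{1..i - 1}. C j - C (j + 1)) = C 1 - C i"
    by (rule UN_differences_decreasing[of l C, OF dec]) (use i in auto)
  \<comment> \<open>Members of \<open>\<A>\<close> lie inside \<open>C 1\<close>, so avoiding
    \<open>C 1 - C i\<close> means lying inside \<open>C i\<close>.\<close>
  then have eq: "\<C>_fam \<A> C i = {X \<in> \<A>. C i - C (i + 1) \<subseteq> X \<and> X \<subseteq> C i}"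
    unfolding \<C>_fam_def using assms(3) by auto
  have mem: "C (i + 1) \<in> \<A>"
    using max i unfolding max_size_chain_def chains_def by auto
  have "C i - C (i + 1) \<subseteq> X" if X: "X \<in> \<A>" "X \<subseteq> C i" "\<not> X \<subseteq> C (i + 1)" for X
  proof -
    have "C (i + 1) \<union> X = C i"
    proof (rule max_size_chain_no_between[OF max dec i])
      show "C (i + 1) \<union> X \<in> \<A>"
        using assms(2) mem X(1) unfolding union_closed_def by blast
    qed (use X dec[OF i] in auto)
    then show ?thesis
      by blast
  qed
  then have "{X \<in> \<A>. X \<subseteq> C i} = {X \<in> \<A>. X \<subseteq> C (i + 1)} \<union> \<C>_fam \<A> C i"
    unfolding eq using dec[OF i] by blast
  \<comment> \<open>Strict inclusion makes \<open>C i - C (i + 1)\<close> nonempty, so no set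
    containing it fits inside \<open>C (i + 1)\<close>.\<close>
  moreover have "{X \<in> \<A>. X \<subseteq> C (i + 1)} \<inter> \<C>_fam \<A> C i = {}"
    unfolding eq using dec[OF i] by blast
  ultimately show ?thesis
    using assms(1) by (simp add: card_Un_disjoint eq)
qed

theorem theorem3p2:
  fixes \<A> :: "nat set set" and C :: "nat \<Rightarrow> nat set" and n l :: nat
  assumes "set_family \<A>"
    and "union_closed \<A>"
    and "universe \<A> = {1..n}"
    and "l = fam_length \<A>"
    and "max_size_chain \<A> (C ` {1..l + 1})"
    and "C 1 = {1..n}"
    and "\<And>i. i \<in> {1..l} \<Longrightarrow> C (i + 1) \<subset> C i"
  shows "card \<A> = 1 + (\<Sum>i=1..l. card (\<D>_fam \<A> C i))"
proof -
  define f where "f i = card {X \<in> \<A>. X \<subseteq> C i}" for i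
  have step: "f i = f (i + 1) + card (\<D>_fam \<A> C i)" if "i \<in> {1..l}" for i
    unfolding f_def card_\<D>_fam
    by (rule card_below_Suc[OF _ assms(2) _ assms(5,7) that])
      (use assms(1,3,6) in \<open>auto simp: set_family_def\<close>)
  have "f 1 = f (k + 1) + (\<Sum>i=1..k. card (\<D>_fam \<A> C i))" if "k \<le> l" for k
    using that
  proof (induction k)
    case (Suc k)
    then show ?case
      using step[of "k + 1"] by simp
  qed simp
  then have "f 1 = f (l + 1) + (\<Sum>i=1..l. card (\<D>_fam \<A> C i))"
    by blast
  moreover have "{X \<in> \<A>. X \<subseteq> C 1} = \<A>"
    using assms(3,6) by auto
  then have "f 1 = card \<A>"
    by (simp add: f_def)
  moreover have "C (l + 1) \<in> \<A>"
    using assms(5) unfolding max_size_chain_def chains_def by auto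
  then have "{X \<in> \<A>. X \<subseteq> C (l + 1)} = {C (l + 1)}"
    using max_size_chain_last_minimal[OF assms(5,7)] by auto
  then have "f (l + 1) = 1"
    by (simp add: f_def)
  ultimately show ?thesis
    by simp
qed

end
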